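(* Let $n\ge1$ and let $g\in\ell^2(\mathbb{Z}^n)$ be a non-zero window function. Then for any $f\in\ell^2(\mathbb{Z}^n)$ and any measurable $\Sigma\subset\mathbb{Z}^n\times\mathbb{T}^n$ such that $(\nu\otimes\mu)(\Sigma)<1$, $$\left\|\chi_{\Sigma^{c}}V_gf\right\|_{L^2(\mathbb{Z}^n\times\mathbb{T}^n)}\ge\sqrt{1-(\nu\otimes\mu)(\Sigma)}\;\|f\|_{\ell^2(\mathbb{Z}^n)}\,\|g\|_{\ell^2(\mathbb{Z}^n)}.$$
   Context: For $f,g\in\ell^2(\mathbb{Z}^n)$ the short-time Fourier transform (STFT) of $f$ with window $g$ is the function on $\mathbb{Z}^n\times\mathbb{T}^n$ (where $\mathbb{T}^n=\mathbb{R}^n/\mathbb{Z}^n$) given by $V_gf(m,w)=\sum_{k\in\mathbb{Z}^n}f(k)\,\overline{g(k-m)}\,e^{-2\pi i w\cdot k}$. The measure $\nu\otimes\mu$ on $\mathbb{Z}^n\times\mathbb{T}^n$ is the product of the counting measure $\nu$ on $\mathbb{Z}^n$ and the Lebesgue measure $\mu$ on $\mathbb{T}^n$ (total mass $1$); $L^2(\mathbb{Z}^n\times\mathbb{T}^n)$ is taken with respect to $\nu\otimes\mu$. $\chi_A$ is the characteristic function of $A$ and $\Sigma^c$ is the complement of $\Sigma$. *)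

theory Defs
  imports "HOL-Analysis.Analysis"
begin

text \<open>
  The lattice \<open>\<int>\<^sup>n\<close> is \<^typ>\<open>int ^ 'n\<close>, where \<open>n = CARD('n) \<ge> 1\<close>; the torus \<open>\<real>\<^sup>n/\<int>\<^sup>n\<close> is
  the following quotient type.
\<close>

quotient_type 'n torus = "real ^ 'n::finite" / "\<lambda>x y. \<forall>i. x $ i - y $ i \<in> \<int>"
  morphisms rep_torus abs_torus
proof (rule equivpI)
  show "reflp (\<lambda>x y :: real ^ 'n. \<forall>i. x $ i - y $ i \<in> \<int>)"
    by (simp add: reflp_def)
  show "symp (\<lambda>x y :: real ^ 'n. \<forall>i. x $ i - y $ i \<in> \<int>)"
    unfolding symp_def by (metis Ints_minus minus_diff_eq)
  show "transp (\<lambda>x y :: real ^ 'n. \<forall>i. x $ i - y $ i \<in> \<int>)"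
  proof (rule transpI, rule allI)
    fix x y z :: "real ^ 'n" and i
    assume "\<forall>i. x $ i - y $ i \<in> \<int>" "\<forall>i. y $ i - z $ i \<in> \<int>"
    then have "(x $ i - y $ i) + (y $ i - z $ i) \<in> \<int>" by (intro Ints_add) auto
    then show "x $ i - z $ i \<in> \<int>" by simp
  qed
qed

definition unit_cube :: "(real ^ 'n::finite) set" where
  "unit_cube = {x. \<forall>i. 0 \<le> x $ i \<and> x $ i < 1}"

text \<open>
  Lebesgue measure on the torus: the image of Lebesgue measure on the fundamental domain
  \<open>[0,1)\<^sup>n\<close> under the quotient map, on the \<open>\<sigma>\<close>-algebra of those sets whose preimage in
  \<open>\<real>\<^sup>n\<close> is Lebesgue measurable.
\<close>

definition torus_measure :: "'n::finite torus measure" where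
  "torus_measure =
     distr (lebesgue_on unit_cube) (sigma UNIV {A. abs_torus -` A \<in> sets lebesgue}) abs_torus"

definition tf_measure :: "((int ^ 'n::finite) \<times> 'n torus) measure" where
  "tf_measure = count_space UNIV \<Otimes>\<^sub>M torus_measure"

lift_definition torus_char :: "int ^ 'n::finite \<Rightarrow> 'n torus \<Rightarrow> complex"
  is "\<lambda>k w. exp (- 2 * of_real pi * \<i> * of_real (\<Sum>i\<in>UNIV. w $ i * of_int (k $ i)))"
proof -
  fix k :: "int ^ 'n" and w w' :: "real ^ 'n"
  assume *: "\<And>i. w $ i - w' $ i \<in> \<int>"
  have "(\<Sum>i\<in>UNIV. (w $ i - w' $ i) * of_int (k $ i)) \<in> \<int>"
    using * by (intro Ints_sum Ints_mult) auto
  then obtain N :: int where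
    "(\<Sum>i\<in>UNIV. (w $ i - w' $ i) * of_int (k $ i)) = of_int N"
    by (auto elim: Ints_cases)
  then have N: "(\<Sum>i\<in>UNIV. w $ i * of_int (k $ i)) =
      (\<Sum>i\<in>UNIV. w' $ i * of_int (k $ i)) + of_int N"
    by (simp add: left_diff_distrib sum_subtractf)
  show "exp (- 2 * of_real pi * \<i> * complex_of_real (\<Sum>i\<in>UNIV. w $ i * of_int (k $ i))) =
        exp (- 2 * of_real pi * \<i> * complex_of_real (\<Sum>i\<in>UNIV. w' $ i * of_int (k $ i)))"
    unfolding N by (subst exp_eq) (rule exI[of _ "- N"], simp add: algebra_simps)
qed

definition in_l2 :: "('a \<Rightarrow> complex) \<Rightarrow> bool" where
  "in_l2 f \<longleftrightarrow> (\<lambda>k. (cmod (f k))\<^sup>2) summable_on UNIV"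

definition l2_norm :: "('a \<Rightarrow> complex) \<Rightarrow> real" where
  "l2_norm f = sqrt (\<Sum>\<^sub>\<infinity>k. (cmod (f k))\<^sup>2)"

text \<open>
  The Bochner integral is \<open>0\<close> when \<open>\<bar>F\<bar>\<^sup>2\<close> is not integrable, so a lower bound on this quantity
  by a positive number includes the claim that \<open>\<bar>F\<bar>\<^sup>2\<close> is integrable.
\<close>

definition L2_norm :: "'a measure \<Rightarrow> ('a \<Rightarrow> complex) \<Rightarrow> real" where
  "L2_norm M F = sqrt (LINT z|M. (cmod (F z))\<^sup>2)"

definition stft ::
  "(int ^ 'n::finite \<Rightarrow> complex) \<Rightarrow> (int ^ 'n \<Rightarrow> complex) \<Rightarrow> (int ^ 'n) \<times> 'n torus \<Rightarrow> complex"
  where "stft g f = (\<lambda>(m, w). \<Sum>\<^sub>\<infinity>k. f k * cnj (g (k - m)) * torus_char k w)"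

end

theory Submission
  imports Defs
begin

text \<open>
  For fixed \<open>m\<close>, the function \<open>w \<mapsto> V\<^sub>g f(m, w)\<close> is the Fourier series with the absolutely
  summable coefficients \<open>f(k) cnj(g(k - m))\<close>. By Cauchy--Schwarz it is bounded by
  \<open>\<parallel>f\<parallel> \<parallel>g\<parallel>\<close>, and Plancherel on the torus followed by Tonelli in \<open>m\<close> gives
  \<open>\<parallel>V\<^sub>g f\<parallel> = \<parallel>f\<parallel> \<parallel>g\<parallel>\<close>. Hence \<open>\<Sigma>\<close> carries at most the fraction \<open>(\<nu> \<otimes> \<mu>)(\<Sigma>)\<close> of
  the total energy \<open>\<parallel>f\<parallel>\<^sup>2 \<parallel>g\<parallel>\<^sup>2\<close>.
\<close>

section \<open>Lebesgue measure on the torus and orthogonality of characters\<close>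

lemma integral_exp_unit_interval:
  fixes a :: int
  shows "integral\<^sup>L lborel (\<lambda>t. indicator {0..<1} t *\<^sub>R exp (- 2 * of_real pi * \<i> * of_real (t * of_int a)))
    = (if a = 0 then 1 else 0)"
proof (cases "a = 0")
  case True
  then show ?thesis by simp
next
  case False
  define c :: complex where "c = - 2 * of_real pi * \<i> * of_int a"
  have c: "c \<noteq> 0" using False by (simp add: c_def)
  \<comment> \<open>\<open>c\<close> is 2 pi i times the integer \<open>- a\<close>, so the
    antiderivative exp(c t) / c takes the same value at both ends of the interval.\<close>
  have exp_c: "exp c = 1"
    unfolding exp_eq_1 by (auto simp: c_def intro!: exI[of _ "- a"])
  \<comment> \<open>Closing the interval adds only the null set {1}; the fundamental theorem of
    calculus is applied on the closed interval.\<close>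
  have "integral\<^sup>L lborel (\<lambda>t. indicator {0..<1} t *\<^sub>R exp (- 2 * of_real pi * \<i> * of_real (t * of_int a)))
      = integral\<^sup>L lborel (\<lambda>t. indicator {0..1} t *\<^sub>R exp (c * of_real t))"
    using AE_lborel_singleton[of "1::real"]
    by (intro integral_cong_AE) (auto simp: c_def indicator_def mult_ac)
  also have "\<dots> = exp (c * of_real 1) / c - exp (c * of_real 0) / c"
  proof (rule integral_FTC_Icc)
    show "((\<lambda>t. exp (c * of_real t) / c) has_vector_derivative exp (c * of_real t)) (at t within {0..1})" for t :: real
    proof -
      have "((\<lambda>z. exp (c * z) / c) has_field_derivative exp (c * of_real t)) (at (of_real t))"
        using c by (auto intro!: derivative_eq_intros)
      then show ?thesis
        by (rule has_vector_derivative_real_field)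
    qed
  qed (auto intro!: continuous_intros)
  finally show ?thesis using False exp_c by simp
qed

text \<open>\<open>lborel\<close> is the image of a finite product of one-dimensional Lebesgue
  measures under the map that sends coordinates to vectors, so Fubini for finite products applies.
  It reduces the integral of a character over the cube to integrals over the unit interval.\<close>

lemma integral_lborel_prod:
  fixes f :: "'a::euclidean_space \<Rightarrow> real \<Rightarrow> 'b::{real_normed_field,banach,second_countable_topology}"
  assumes f: "\<And>b. b \<in> Basis \<Longrightarrow> integrable lborel (f b)"
  shows "(\<integral>x. (\<Prod>b\<in>Basis. f b (x \<bullet> b)) \<partial>lborel) = (\<Prod>b\<in>Basis. integral\<^sup>L lborel (f b))"
proof -
  interpret product_sigma_finite "\<lambda>_::'a. lborel :: real measure"
    by standard
  have [measurable]: "f b \<in> borel_measurable borel" if "b \<in> Basis" for b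
    using f[OF that] by simp
  have "(\<integral>x. (\<Prod>b\<in>Basis. f b (x \<bullet> b)) \<partial>lborel)
      = (\<integral>x. (\<Prod>b\<in>Basis. f b ((\<Sum>b\<in>Basis. x b *\<^sub>R b) \<bullet> b)) \<partial>(\<Pi>\<^sub>M b\<in>(Basis::'a set). lborel))"
    by (subst lborel_eq, subst integral_distr) auto
  also have "\<dots> = (\<integral>x. (\<Prod>b\<in>Basis. f b (x b)) \<partial>(\<Pi>\<^sub>M b\<in>(Basis::'a set). lborel))"
    by (intro Bochner_Integration.integral_cong prod.cong) simp_all
  also have "\<dots> = (\<Prod>b\<in>Basis. integral\<^sup>L lborel (f b))"
    by (rule product_integral_prod) (use f in auto)
  finally show ?thesis .
qed

lemma unit_cube_eq: "unit_cube = {x :: real ^ 'n::finite. \<forall>b\<in>Basis. 0 \<le> x \<bullet> b \<and> x \<bullet> b < 1}"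
  by (auto simp: unit_cube_def Basis_vec_def inner_axis)

lemma unit_cube_borel [measurable]: "unit_cube \<in> sets (borel :: (real ^ 'n::finite) measure)"
  unfolding unit_cube_eq by measurable

text \<open>The half-open cube lies between the open and the closed unit box, both of volume
  1.\<close>

lemma emeasure_unit_cube: "emeasure lborel (unit_cube :: (real ^ 'n::finite) set) = 1"
proof (rule antisym)
  have "emeasure lborel (unit_cube :: (real ^ 'n) set) \<le> emeasure lborel (cbox 0 One :: (real ^ 'n) set)"
    by (intro emeasure_mono) (auto simp: unit_cube_eq mem_box less_imp_le)
  then show "emeasure lborel (unit_cube :: (real ^ 'n) set) \<le> 1" by simp
  have "emeasure lborel (box 0 One :: (real ^ 'n) set) \<le> emeasure lborel (unit_cube :: (real ^ 'n) set)"
    by (intro emeasure_mono) (auto simp: unit_cube_eq mem_box less_imp_le)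
  then show "1 \<le> emeasure lborel (unit_cube :: (real ^ 'n) set)" by simp
qed

text \<open>Preimages commute with complements and countable unions, so the generating family is
  already a sigma-algebra and \<open>sigma\<close> adds no sets to it. Measurability on the torus
  thus becomes a question about periodic lifts to the whole of R^n.\<close>

lemma sets_torus_measure:
  fixes A :: "'n::finite torus set"
  shows "A \<in> sets torus_measure \<longleftrightarrow> abs_torus -` A \<in> sets lebesgue"
proof -
  have "sigma_algebra UNIV {A :: 'n torus set. abs_torus -` A \<in> sets lebesgue}"
    by (rule sigma_algebra_iff2[THEN iffD2])
      (auto simp: vimage_UN vimage_Diff intro!: sets.countable_UN sets.Diff)
  then show ?thesis
    by (simp add: torus_measure_def sigma_algebra.sigma_sets_eq)
qed

lemma space_torus_measure [simp]: "space torus_measure = UNIV"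
  by (simp add: torus_measure_def)

lemma measurable_torus_measure_iff:
  "f \<in> borel_measurable torus_measure \<longleftrightarrow> (\<lambda>x. f (abs_torus x)) \<in> borel_measurable lebesgue"
  by (simp add: measurable_def sets_torus_measure vimage_def)

lemma abs_torus_measurable:
  "abs_torus \<in> lebesgue_on unit_cube \<rightarrow>\<^sub>M sigma UNIV {A. abs_torus -` A \<in> sets lebesgue}"
  by (rule measurable_measure_of) (auto intro!: sets_restrict_space_iff[THEN iffD2] simp: sets_restrict_space)

lemma emeasure_torus_measure: "emeasure (torus_measure :: 'n::finite torus measure) UNIV = 1"
proof -
  have "emeasure (torus_measure :: 'n torus measure) UNIV = emeasure (lebesgue_on (unit_cube :: (real ^ 'n) set)) unit_cube"
    unfolding torus_measure_def by (subst emeasure_distr[OF abs_torus_measurable]) auto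
  also have "\<dots> = 1"
    by (simp add: emeasure_restrict_space emeasure_unit_cube)
  finally show ?thesis .
qed

lemma finite_measure_torus_measure: "finite_measure torus_measure"
  by (rule finite_measureI) (simp add: emeasure_torus_measure)

lemma torus_char_measurable [measurable]: "torus_char k \<in> borel_measurable torus_measure"
proof -
  have "continuous_on UNIV (\<lambda>x. torus_char k (abs_torus x))"
    unfolding torus_char.abs_eq by (intro continuous_intros)
  then show ?thesis unfolding measurable_torus_measure_iff
    by (intro measurable_completion) (simp add: borel_measurable_continuous_onI)
qed

lemma norm_torus_char [simp]: "cmod (torus_char k w) = 1"
  by (transfer, simp add: norm_exp_eq_Re)

lemma torus_char_mult_cnj: "torus_char k w * cnj (torus_char l w) = torus_char (k - l) w"
  by transfer (simp add: exp_cnj flip: exp_add, simp add: algebra_simps sum_subtractf)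

text \<open>Pulled back to the cube, a character is a product of one-variable exponentials. If some
  coordinate of \<open>k\<close> is nonzero, the factor for that axis integrates to 0; otherwise
  every factor is 1.\<close>

lemma integral_torus_char:
  fixes k :: "int ^ 'n::finite"
  shows "integral\<^sup>L torus_measure (torus_char k) = (if k = 0 then 1 else 0)"
proof -
  define k' :: "real ^ 'n" where "k' = (\<chi> i. of_int (k $ i))"
  \<comment> \<open>On basis vectors \<open>k' \<bullet> b\<close> is a coordinate of
    \<open>k\<close> cast to the reals. The floor turns it back into an integer, as
    \<open>integral_exp_unit_interval\<close> requires.\<close>
  define f :: "real ^ 'n \<Rightarrow> real \<Rightarrow> complex" where
    "f b t = indicator {0..<1} t *\<^sub>R exp (- 2 * of_real pi * \<i> * of_real (t * of_int \<lfloor>k' \<bullet> b\<rfloor>))" for b t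
  have k'_int: "of_int \<lfloor>k' \<bullet> b\<rfloor> = k' \<bullet> b" if "b \<in> Basis" for b
    using that by (auto simp: k'_def Basis_vec_def inner_axis)
  have "integral\<^sup>L torus_measure (torus_char k)
      = integral\<^sup>L (lebesgue_on unit_cube) (\<lambda>x. torus_char k (abs_torus x))"
    using torus_char_measurable[of k] unfolding torus_measure_def
    by (intro integral_distr[OF abs_torus_measurable]) simp
  \<comment> \<open>\<open>lebesgue\<close> is the completion of \<open>lborel\<close> and the
    integrand is Borel measurable, so the integral can be taken over \<open>lborel\<close>, which
    has a product structure.\<close>
  also have "\<dots> = integral\<^sup>L lborel (\<lambda>x. indicator unit_cube x *\<^sub>R torus_char k (abs_torus x))"
    apply (subst integral_restrict_space, simp)
    apply (subst integral_completion)
    unfolding torus_char.abs_eq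
     apply measurable
    done
  also have "\<dots> = integral\<^sup>L lborel (\<lambda>x. \<Prod>b\<in>Basis. f b (x \<bullet> b))"
  proof (rule Bochner_Integration.integral_cong[OF refl])
    fix x :: "real ^ 'n"
    have ind: "(indicator unit_cube x :: real) = (\<Prod>b\<in>Basis. indicator {0..<1} (x \<bullet> b))"
      by (auto simp: unit_cube_eq indicator_def prod_zero_iff)
    have "(\<Sum>i\<in>UNIV. x $ i * of_int (k $ i)) = x \<bullet> k'"
      by (simp add: inner_vec_def k'_def)
    also have "\<dots> = (\<Sum>b\<in>Basis. (x \<bullet> b) * of_int \<lfloor>k' \<bullet> b\<rfloor>)"
      by (subst euclidean_inner) (simp add: k'_int)
    finally have "torus_char k (abs_torus x) = (\<Prod>b\<in>Basis. exp (- 2 * of_real pi * \<i> * of_real ((x \<bullet> b) * of_int \<lfloor>k' \<bullet> b\<rfloor>)))"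
      by (simp only: torus_char.abs_eq of_real_sum sum_distrib_left exp_sum[OF finite_Basis])
    then show "indicator unit_cube x *\<^sub>R torus_char k (abs_torus x) = (\<Prod>b\<in>Basis. f b (x \<bullet> b))"
      by (simp add: f_def ind scaleR_conv_of_real prod.distrib)
  qed
  also have "\<dots> = (\<Prod>b\<in>Basis. integral\<^sup>L lborel (f b))"
  proof (rule integral_lborel_prod)
    fix b
    show "integrable lborel (f b)"
      unfolding f_def
      by (rule integrableI_bounded_set_indicator[where B=1]) (auto simp: norm_exp_eq_Re)
  qed
  also have "\<dots> = (\<Prod>b\<in>Basis. if \<lfloor>k' \<bullet> b\<rfloor> = 0 then 1 else 0)"
    unfolding f_def integral_exp_unit_interval ..
  also have "\<dots> = (if k = 0 then 1 else 0)"
  proof (cases "k = 0")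
    case True
    then show ?thesis by (auto simp: k'_def inner_vec_def)
  next
    case False
    then obtain i where "k $ i \<noteq> 0" by (auto simp: vec_eq_iff)
    then have "\<lfloor>k' \<bullet> axis i 1\<rfloor> \<noteq> 0" by (simp add: k'_def inner_axis)
    moreover have "axis i 1 \<in> (Basis :: (real ^ 'n) set)" by (auto simp: Basis_vec_def)
    ultimately show ?thesis using False by (auto simp: prod_zero_iff)
  qed
  finally show ?thesis .
qed


section \<open>Square-summable sequences and Cauchy-Schwarz\<close>

text \<open>Passes from infinite sums to integrals over the counting measure, so that the integral
  forms of Cauchy-Schwarz, Fubini and Tonelli apply to sums.\<close>

lemma in_l2_integrable:
  assumes "in_l2 f"
  shows "integrable (count_space UNIV) (\<lambda>k. (cmod (f k))\<^sup>2)"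
    and "(\<integral>k. (cmod (f k))\<^sup>2 \<partial>count_space UNIV) = (l2_norm f)\<^sup>2"
proof -
  show *: "integrable (count_space UNIV) (\<lambda>k. (cmod (f k))\<^sup>2)"
    using assms by (simp add: in_l2_def flip: abs_summable_on_def abs_summable_equivalent)
  have "(\<integral>k. (cmod (f k))\<^sup>2 \<partial>count_space UNIV) = (\<Sum>\<^sub>\<infinity>k. (cmod (f k))\<^sup>2)"
    using infsetsum_infsum[unfolded abs_summable_on_def infsetsum_def, OF *] by simp
  also have "\<dots> = (l2_norm f)\<^sup>2"
    by (simp add: l2_norm_def infsum_nonneg)
  finally show "(\<integral>k. (cmod (f k))\<^sup>2 \<partial>count_space UNIV) = (l2_norm f)\<^sup>2" .
qed

lemma nn_integral_in_l2:
  assumes "in_l2 f"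
  shows "(\<integral>\<^sup>+k. ennreal ((cmod (f k))\<^sup>2) \<partial>count_space UNIV) = ennreal ((l2_norm f)\<^sup>2)"
  using in_l2_integrable[OF assms] by (simp add: nn_integral_eq_integral)

text \<open>Both k -> k - m and m -> k - m are bijections of the group. The sum over
  \<open>k\<close> enters Cauchy-Schwarz for fixed \<open>m\<close>; the sum over \<open>m\<close>
  enters the energy identity after the order of summation is exchanged.\<close>

lemma nn_integral_in_l2_translate:
  fixes g :: "'a::ab_group_add \<Rightarrow> complex"
  assumes "in_l2 g"
  shows "(\<integral>\<^sup>+k. ennreal ((cmod (g (k - m)))\<^sup>2) \<partial>count_space UNIV) = ennreal ((l2_norm g)\<^sup>2)"
    and "(\<integral>\<^sup>+m. ennreal ((cmod (g (k - m)))\<^sup>2) \<partial>count_space UNIV) = ennreal ((l2_norm g)\<^sup>2)"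
proof -
  have "bij_betw (\<lambda>k. k - m) UNIV UNIV"
    by (rule bij_betwI[where g="\<lambda>k. k + m"]) auto
  from nn_integral_bij_count_space[OF this, of "\<lambda>k. ennreal ((cmod (g k))\<^sup>2)"]
  show "(\<integral>\<^sup>+k. ennreal ((cmod (g (k - m)))\<^sup>2) \<partial>count_space UNIV) = ennreal ((l2_norm g)\<^sup>2)"
    by (simp add: nn_integral_in_l2[OF assms])
  have "bij_betw (\<lambda>m. k - m) UNIV UNIV"
    by (rule bij_betwI[where g="\<lambda>m. k - m"]) auto
  from nn_integral_bij_count_space[OF this, of "\<lambda>k. ennreal ((cmod (g k))\<^sup>2)"]
  show "(\<integral>\<^sup>+m. ennreal ((cmod (g (k - m)))\<^sup>2) \<partial>count_space UNIV) = ennreal ((l2_norm g)\<^sup>2)"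
    by (simp add: nn_integral_in_l2[OF assms])
qed

text \<open>Cauchy-Schwarz is applied in the extended nonnegative reals, where no convergence has to
  be known beforehand; the one estimate then yields both summability and the bound.\<close>

lemma in_l2_product:
  fixes f g :: "'a::ab_group_add \<Rightarrow> complex"
  assumes f: "in_l2 f" and g: "in_l2 g"
  shows "integrable (count_space UNIV) (\<lambda>k. f k * cnj (g (k - m)))"
    and "(\<integral>k. cmod (f k * cnj (g (k - m))) \<partial>count_space UNIV) \<le> l2_norm f * l2_norm g"
proof -
  define I where "I = (\<integral>\<^sup>+k. ennreal (cmod (f k * cnj (g (k - m)))) \<partial>count_space UNIV)"
  have "I\<^sup>2 = (\<integral>\<^sup>+k. ennreal (cmod (f k)) * ennreal (cmod (g (k - m))) \<partial>count_space UNIV)\<^sup>2"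
    by (simp add: I_def norm_mult ennreal_mult)
  also have "\<dots> \<le> (\<integral>\<^sup>+k. (ennreal (cmod (f k)))\<^sup>2 \<partial>count_space UNIV) *
      (\<integral>\<^sup>+k. (ennreal (cmod (g (k - m))))\<^sup>2 \<partial>count_space UNIV)"
    by (rule Cauchy_Schwarz_nn_integral) auto
  also have "\<dots> = ennreal ((l2_norm f)\<^sup>2) * ennreal ((l2_norm g)\<^sup>2)"
    by (simp add: ennreal_power nn_integral_in_l2[OF f] nn_integral_in_l2_translate[OF g])
  also have "\<dots> = ennreal ((l2_norm f * l2_norm g)\<^sup>2)"
    by (simp add: power_mult_distrib ennreal_mult)
  finally have I2: "I\<^sup>2 \<le> ennreal ((l2_norm f * l2_norm g)\<^sup>2)" .
  \<comment> \<open>An infinite \<open>I\<close> would have an infinite square, against the finite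
    bound.\<close>
  then have "I \<noteq> \<infinity>"
    by (auto simp: power2_eq_square top_unique)
  then show int: "integrable (count_space UNIV) (\<lambda>k. f k * cnj (g (k - m)))"
    by (intro integrableI_bounded) (auto simp: I_def less_top)
  have nonneg: "l2_norm f * l2_norm g \<ge> 0"
    by (simp add: l2_norm_def infsum_nonneg)
  have "I = ennreal (\<integral>k. cmod (f k * cnj (g (k - m))) \<partial>count_space UNIV)"
    unfolding I_def using int by (intro nn_integral_eq_integral) auto
  with I2 have "(\<integral>k. cmod (f k * cnj (g (k - m))) \<partial>count_space UNIV)\<^sup>2 \<le> (l2_norm f * l2_norm g)\<^sup>2"
    by (simp add: ennreal_power)
  then show "(\<integral>k. cmod (f k * cnj (g (k - m))) \<partial>count_space UNIV) \<le> l2_norm f * l2_norm g"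
    by (rule power2_le_imp_le[OF _ nonneg])
qed

section \<open>Fourier series with absolutely summable coefficients\<close>

text \<open>The sum is written as an integral over the counting measure so that exchanging it with
  the torus integral is an instance of Fubini.\<close>

definition fourier_series :: "(int ^ 'n::finite \<Rightarrow> complex) \<Rightarrow> 'n torus \<Rightarrow> complex" where
  "fourier_series c w = (\<integral>k. c k * torus_char k w \<partial>count_space UNIV)"

lemma infsum_eq_fourier_series:
  assumes "integrable (count_space UNIV) c"
  shows "(\<Sum>\<^sub>\<infinity>k. c k * torus_char k w) = fourier_series c w"
proof -
  have "integrable (count_space UNIV) (\<lambda>k. c k * torus_char k w)"
    by (rule Bochner_Integration.integrable_bound[OF assms]) (auto simp: norm_mult)
  from infsetsum_infsum[unfolded abs_summable_on_def infsetsum_def, OF this] show ?thesis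
    by (simp add: fourier_series_def)
qed

text \<open>Characters have modulus 1, so the bound is uniform in \<open>w\<close>. It makes the
  series an admissible bounded test function in its own Plancherel identity, and later bounds the
  STFT pointwise.\<close>

lemma norm_fourier_series_le: "cmod (fourier_series c w) \<le> (\<integral>k. cmod (c k) \<partial>count_space UNIV)"
  unfolding fourier_series_def
  using integral_norm_bound[of "count_space UNIV" "\<lambda>k. c k * torus_char k w"]
  by (simp add: norm_mult)

lemma pair_sigma_finite_torus:
  "pair_sigma_finite (count_space (UNIV :: 'a::countable set)) (torus_measure :: 'n::finite torus measure)"
proof -
  interpret finite_measure "torus_measure :: 'n torus measure"
    by (rule finite_measure_torus_measure)
  show ?thesis
    by (intro pair_sigma_finite.intro sigma_finite_measure_count_space) unfold_locales
qed

text \<open>The double integral converges absolutely: for each \<open>k\<close> the torus integral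
  of the modulus is |c k| times the fixed finite integral of |h|, and \<open>c\<close> is summable.
  Three test functions \<open>h\<close> are used below: the constant 1 for measurability, a
  conjugate character for the coefficients, and the conjugate of the series itself for
  Plancherel.\<close>

lemma fourier_series_Fubini:
  fixes c :: "int ^ 'n::finite \<Rightarrow> complex"
  assumes c: "integrable (count_space UNIV) c"
    and h [measurable]: "h \<in> borel_measurable torus_measure"
    and B: "\<And>w. cmod (h w) \<le> B"
  shows "integrable torus_measure (\<lambda>w. fourier_series c w * h w)"
    and "integrable (count_space UNIV) (\<lambda>k. c k * (\<integral>w. torus_char k w * h w \<partial>torus_measure))"
    and "(\<integral>w. fourier_series c w * h w \<partial>torus_measure)
      = (\<integral>k. c k * (\<integral>w. torus_char k w * h w \<partial>torus_measure) \<partial>count_space UNIV)"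
proof -
  interpret T: finite_measure "torus_measure :: 'n torus measure"
    by (rule finite_measure_torus_measure)
  interpret pair_sigma_finite "count_space (UNIV :: (int ^ 'n) set)" "torus_measure :: 'n torus measure"
    by (rule pair_sigma_finite_torus)
  have eh: "integrable torus_measure (\<lambda>w. torus_char k w * h w)" for k
    by (rule T.integrable_const_bound[where B=B]) (auto simp: norm_mult B)
  have int: "integrable (count_space UNIV \<Otimes>\<^sub>M torus_measure) (\<lambda>(k, w). c k * (torus_char k w * h w))"
  proof (rule Fubini_integrable)
    \<comment> \<open>The first factor is countable and discrete, so only the sections in
      \<open>w\<close> need to be measurable.\<close>
    show "(\<lambda>(k, w). c k * (torus_char k w * h w)) \<in> borel_measurable (count_space UNIV \<Otimes>\<^sub>M torus_measure)"
      by (rule measurable_pair_measure_countable1) auto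
    have "integrable (count_space UNIV) (\<lambda>k. cmod (c k) * (\<integral>w. cmod (h w) \<partial>torus_measure))"
      using c by simp
    then show "integrable (count_space UNIV)
        (\<lambda>k. \<integral>w. norm (case (k, w) of (k, w) \<Rightarrow> c k * (torus_char k w * h w)) \<partial>torus_measure)"
      by (simp add: norm_mult)
  qed (simp add: eh)
  have S: "(\<integral>k. c k * (torus_char k w * h w) \<partial>count_space UNIV) = fourier_series c w * h w" for w
    by (simp add: fourier_series_def mult.assoc[symmetric])
  show "integrable torus_measure (\<lambda>w. fourier_series c w * h w)"
    using integrable_snd[OF int] by (simp only: S)
  show "integrable (count_space UNIV) (\<lambda>k. c k * (\<integral>w. torus_char k w * h w \<partial>torus_measure))"
    using integrable_fst[OF int] by simp
  show "(\<integral>w. fourier_series c w * h w \<partial>torus_measure)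
      = (\<integral>k. c k * (\<integral>w. torus_char k w * h w \<partial>torus_measure) \<partial>count_space UNIV)"
    using Fubini_integral[OF int] by (simp add: S)
qed

lemma fourier_series_measurable:
  "integrable (count_space UNIV) c \<Longrightarrow> fourier_series c \<in> borel_measurable torus_measure"
  using fourier_series_Fubini(1)[of c "\<lambda>_. 1" 1] by (simp add: borel_measurable_integrable)

lemma cnj_measurable [measurable]: "cnj \<in> borel_measurable borel"
  by (intro borel_measurable_continuous_onI continuous_intros)

text \<open>After integrating term by term, orthogonality of the characters leaves only the term k =
  j.\<close>

lemma fourier_coefficient:
  assumes "integrable (count_space UNIV) c"
  shows "(\<integral>w. fourier_series c w * cnj (torus_char j w) \<partial>torus_measure) = c j"
proof -
  have "(\<integral>w. fourier_series c w * cnj (torus_char j w) \<partial>torus_measure)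
      = (\<integral>k. c k * (if k - j = 0 then 1 else 0) \<partial>count_space UNIV)"
    by (subst fourier_series_Fubini(3)[OF assms, where B=1])
      (auto simp: torus_char_mult_cnj integral_torus_char)
  also have "\<dots> = (\<integral>k. indicator {j} k *\<^sub>R c j \<partial>count_space UNIV)"
    by (intro Bochner_Integration.integral_cong) auto
  also have "\<dots> = c j"
    by simp
  finally show ?thesis .
qed

text \<open>The series is integrated term by term against its own conjugate. By
  \<open>fourier_coefficient\<close>, the integral of the k-th character against that conjugate is
  the conjugate of c k, so the k-th term becomes |c k|^2.\<close>

lemma fourier_series_Plancherel:
  fixes c :: "int ^ 'n::finite \<Rightarrow> complex"
  assumes c: "integrable (count_space UNIV) c"
  shows "(\<integral>\<^sup>+w. ennreal ((cmod (fourier_series c w))\<^sup>2) \<partial>torus_measure)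
    = (\<integral>\<^sup>+k. ennreal ((cmod (c k))\<^sup>2) \<partial>count_space UNIV)"
proof -
  have [measurable]: "fourier_series c \<in> borel_measurable torus_measure"
    by (rule fourier_series_measurable[OF c])
  have coeff: "(\<integral>w. torus_char k w * cnj (fourier_series c w) \<partial>torus_measure) = cnj (c k)" for k
  proof -
    have "cnj (c k) = (\<integral>w. cnj (fourier_series c w * cnj (torus_char k w)) \<partial>torus_measure)"
      by (subst Bochner_Integration.integral_cnj) (simp only: fourier_coefficient[OF c])
    then show ?thesis by (simp add: mult.commute)
  qed
  \<comment> \<open>\<open>norm_fourier_series_le\<close> supplies the bound \<open>B\<close>. The
    resulting facts concern squared moduli embedded in the complex numbers; the next three steps
    bring them back to the reals.\<close>
  note F = fourier_series_Fubini[OF c, where h="\<lambda>w. cnj (fourier_series c w)",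
      unfolded coeff complex_norm_square[symmetric] complex_mod_cnj,
      OF _ norm_fourier_series_le]
  have 1: "integrable torus_measure (\<lambda>w. (cmod (fourier_series c w))\<^sup>2)"
    using integrable_Re[OF F(1)] by (simp del: of_real_power)
  have 2: "integrable (count_space UNIV) (\<lambda>k. (cmod (c k))\<^sup>2)"
    using integrable_Re[OF F(2)] by (simp del: of_real_power)
  have 3: "(\<integral>w. (cmod (fourier_series c w))\<^sup>2 \<partial>torus_measure) = (\<integral>k. (cmod (c k))\<^sup>2 \<partial>count_space UNIV)"
    using F(3) by (simp del: of_real_power)
  show ?thesis
    using 1 2 3 by (simp add: nn_integral_eq_integral)
qed

section \<open>The short-time Fourier transform: sup bound, energy identity and uncertainty
  inequality\<close>

lemma stft_eq_fourier_series:
  assumes "in_l2 f" "in_l2 g"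
  shows "stft g f (m, w) = fourier_series (\<lambda>k. f k * cnj (g (k - m))) w"
  unfolding stft_def using infsum_eq_fourier_series[OF in_l2_product(1)[OF assms]] by simp

lemma norm_stft_le:
  assumes "in_l2 f" "in_l2 g"
  shows "cmod (stft g f z) \<le> l2_norm f * l2_norm g"
  using norm_fourier_series_le in_l2_product(2)[OF assms]
  by (cases z) (auto simp: stft_eq_fourier_series[OF assms] intro: order_trans)

lemma stft_measurable:
  assumes "in_l2 f" "in_l2 g"
  shows "stft g f \<in> borel_measurable tf_measure"
  unfolding tf_measure_def
  by (rule measurable_pair_measure_countable1)
    (auto simp: stft_eq_fourier_series[OF assms] intro!: fourier_series_measurable in_l2_product assms)

text \<open>Plancherel in \<open>w\<close> turns the energy of each slice into a sum over
  \<open>k\<close>. Nonnegative integrals are used throughout, so no prior integrability of the STFT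
  is needed and its square-integrability follows from the finite value.\<close>

lemma stft_Moyal:
  fixes f g :: "int ^ 'n::finite \<Rightarrow> complex"
  assumes f: "in_l2 f" and g: "in_l2 g"
  shows "(\<integral>\<^sup>+z. ennreal ((cmod (stft g f z))\<^sup>2) \<partial>tf_measure) = ennreal ((l2_norm f * l2_norm g)\<^sup>2)"
proof -
  interpret pair_sigma_finite "count_space (UNIV :: (int ^ 'n) set)" "torus_measure :: 'n torus measure"
    by (rule pair_sigma_finite_torus)
  have "(\<integral>\<^sup>+z. ennreal ((cmod (stft g f z))\<^sup>2) \<partial>tf_measure)
      = (\<integral>\<^sup>+m. \<integral>\<^sup>+w. ennreal ((cmod (stft g f (m, w)))\<^sup>2) \<partial>torus_measure \<partial>count_space UNIV)"
    using stft_measurable[OF f g] unfolding tf_measure_def by (subst M2.nn_integral_fst) simp_all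
  also have "\<dots> = (\<integral>\<^sup>+m. \<integral>\<^sup>+k. ennreal ((cmod (f k))\<^sup>2) * ennreal ((cmod (g (k - m)))\<^sup>2)
      \<partial>count_space UNIV \<partial>count_space UNIV)"
    by (simp add: stft_eq_fourier_series[OF f g] fourier_series_Plancherel[OF in_l2_product(1)[OF f g]]
        norm_mult power_mult_distrib ennreal_mult)
  \<comment> \<open>Tonelli for counting measures: both iterated sums equal the sum over all pairs.
    With \<open>m\<close> innermost, the sum of |g(k - m)|^2 no longer depends on \<open>k\<close>
    and factors out.\<close>
  also have "\<dots> = (\<integral>\<^sup>+k. \<integral>\<^sup>+m. ennreal ((cmod (f k))\<^sup>2) * ennreal ((cmod (g (k - m)))\<^sup>2)
      \<partial>count_space UNIV \<partial>count_space UNIV)"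
    using nn_integral_fst_count_space[of "\<lambda>(m, k). ennreal ((cmod (f k))\<^sup>2) * ennreal ((cmod (g (k - m)))\<^sup>2)"]
      nn_integral_snd_count_space[of "\<lambda>(m, k). ennreal ((cmod (f k))\<^sup>2) * ennreal ((cmod (g (k - m)))\<^sup>2)"]
    by simp
  also have "\<dots> = ennreal ((l2_norm f)\<^sup>2) * ennreal ((l2_norm g)\<^sup>2)"
    by (simp add: nn_integral_cmult nn_integral_multc nn_integral_in_l2_translate(2)[OF g] nn_integral_in_l2[OF f])
  also have "\<dots> = ennreal ((l2_norm f * l2_norm g)\<^sup>2)"
    by (simp add: power_mult_distrib ennreal_mult)
  finally show ?thesis .
qed

theorem proposition3p4:
  fixes f g :: "int ^ 'n::finite \<Rightarrow> complex"
    and \<Sigma> :: "((int ^ 'n) \<times> 'n torus) set"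
  assumes "in_l2 g" and "g \<noteq> (\<lambda>_. 0)"
    and "in_l2 f"
    and "\<Sigma> \<in> sets tf_measure"
    and "emeasure tf_measure \<Sigma> < 1"
  shows "L2_norm tf_measure (\<lambda>z. indicator (- \<Sigma>) z * stft g f z)
           \<ge> sqrt (1 - measure tf_measure \<Sigma>) * l2_norm f * l2_norm g"
proof -
  define V where "V z = (cmod (stft g f z))\<^sup>2" for z
  define N where "N = l2_norm f * l2_norm g"
  have N: "N \<ge> 0"
    by (simp add: N_def l2_norm_def infsum_nonneg)
  have [measurable]: "stft g f \<in> borel_measurable tf_measure"
    by (rule stft_measurable) fact+
  have \<Sigma> [measurable]: "\<Sigma> \<in> sets tf_measure" by fact
  have fin: "emeasure tf_measure \<Sigma> < \<infinity>"
    using assms(5) by (rule less_trans) simp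
  have [measurable]: "V \<in> borel_measurable tf_measure"
    unfolding V_def[abs_def] by measurable
  have nnV: "(\<integral>\<^sup>+z. ennreal (V z) \<partial>tf_measure) = ennreal (N\<^sup>2)"
    unfolding V_def N_def by (rule stft_Moyal) fact+
  \<comment> \<open>Genuine integrability matters because the Bochner integral in
    \<open>L2_norm\<close> would default to 0 without it.\<close>
  have V: "integrable tf_measure V"
    by (rule integrableI_nonneg) (auto simp: nnV, auto simp: V_def)
  have intV: "integral\<^sup>L tf_measure V = N\<^sup>2"
    using nnV by (subst integral_eq_nn_integral) (auto simp: V_def)
  have V\<Sigma>: "integrable tf_measure (\<lambda>z. indicator \<Sigma> z * V z)"
    using integrable_mult_indicator[OF \<Sigma> V] by simp
  \<comment> \<open>The sup bound gives V <= N^2 everywhere, so the energy on \<Sigma> is at most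
    its measure times N^2; finiteness of that measure makes the constant integrable over
    \<Sigma>.\<close>
  have "(\<integral>z. indicator \<Sigma> z * V z \<partial>tf_measure) \<le> (\<integral>z. indicator \<Sigma> z * N\<^sup>2 \<partial>tf_measure)"
  proof (rule integral_mono[OF V\<Sigma>])
    show "integrable tf_measure (\<lambda>z. indicator \<Sigma> z * N\<^sup>2)"
      using \<Sigma> fin by simp
    show "indicator \<Sigma> z * V z \<le> indicator \<Sigma> z * N\<^sup>2" for z
      unfolding V_def N_def
      by (intro mult_left_mono power_mono norm_stft_le assms(1,3)) auto
  qed
  also have "\<dots> = measure tf_measure \<Sigma> * N\<^sup>2"
    using sets.sets_into_space[OF \<Sigma>] by (simp add: Int_absorb2)
  finally have le: "(\<integral>z. indicator \<Sigma> z * V z \<partial>tf_measure) \<le> measure tf_measure \<Sigma> * N\<^sup>2" .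
  \<comment> \<open>The indicator of the complement equals its own square and is 1 minus the
    indicator of \<Sigma>, so the energy off \<Sigma> is the total energy N^2 minus the energy on
    \<Sigma>.\<close>
  have "(\<integral>z. (cmod (indicator (- \<Sigma>) z * stft g f z))\<^sup>2 \<partial>tf_measure)
      = (\<integral>z. V z - indicator \<Sigma> z * V z \<partial>tf_measure)"
    by (intro Bochner_Integration.integral_cong) (auto simp: V_def indicator_def)
  also have "\<dots> = N\<^sup>2 - (\<integral>z. indicator \<Sigma> z * V z \<partial>tf_measure)"
    using V V\<Sigma> by (simp add: intV)
  also have "\<dots> \<ge> (1 - measure tf_measure \<Sigma>) * N\<^sup>2"
    using le by (simp add: algebra_simps)
  finally have "sqrt ((1 - measure tf_measure \<Sigma>) * N\<^sup>2)
      \<le> L2_norm tf_measure (\<lambda>z. indicator (- \<Sigma>) z * stft g f z)"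
    unfolding L2_norm_def by (rule real_sqrt_le_mono)
  then show ?thesis
    using N by (simp add: real_sqrt_mult N_def mult.assoc)
qed

end
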